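(* For all integers $n\ge 1$ and $r\ge 0$, \[ L_n^{(r)} = F_{n-1}^{(r)} + F_{n+1} ^{(r)} + \binom{n+r-1}{r-1}. \]
   Context: $(F_n)_{n\ge 0}$ is the Fibonacci sequence ($F_0=0$, $F_1=1$, $F_{n+2}=F_{n+1}+F_n$) and $(L_n)_{n\ge 0}$ is the Lucas sequence ($L_0=2$, $L_1=1$, $L_{n+2}=L_{n+1}+L_n$). The hyperfibonacci sequence of $r$-th generation is defined by $F_n^{(0)}=F_n$ and, for $r\ge 1$, $F_n^{(r)}=\sum_{k=0}^n F_k^{(r-1)}$. The hyperlucas sequence of $r$-th generation is defined by $L_n^{(0)}=L_n$ and, for $r\ge 1$, $L_n^{(r)}=\sum_{k=0}^n L_k^{(r-1)}$. Convention: $\binom{a}{-1}=0$. *)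

theory Defs
  imports "HOL-Number_Theory.Fib"
begin

fun lucas :: "nat \<Rightarrow> nat" where
  "lucas 0 = 2"
| "lucas (Suc 0) = 1"
| "lucas (Suc (Suc n)) = lucas (Suc n) + lucas n"

(* hyperfib r n is F_n^(r) and hyperlucas r n is L_n^(r): the generation r comes first. *)

fun hyperfib :: "nat \<Rightarrow> nat \<Rightarrow> nat" where
  "hyperfib 0 n = fib n"
| "hyperfib (Suc r) n = (\<Sum>k=0..n. hyperfib r k)"

fun hyperlucas :: "nat \<Rightarrow> nat \<Rightarrow> nat" where
  "hyperlucas 0 n = lucas n"
| "hyperlucas (Suc r) n = (\<Sum>k=0..n. hyperlucas r k)"

(* Binomial coefficient with an integer lower index, zero when that index is negative;
   on natural numbers r - 1 would truncate to 0 at r = 0 and give the value 1 instead. *)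
definition binom :: "nat \<Rightarrow> int \<Rightarrow> nat" where
  "binom a k = (if k < 0 then 0 else a choose nat k)"

end

theory Submission
  imports Defs
begin

text \<open>Splitting off the last summand gives X(r+1, n+1) = X(r+1, n) + X(r, n+1) for
  \<open>hyperfib\<close> and \<open>hyperlucas\<close>; by Pascal's rule
  (\<open>binom_pascal\<close>) the binomial term obeys the same recurrence. So the identity
  propagates by double induction from r = 0, the classical relation between Lucas and Fibonacci
  numbers, and from the smallest index.\<close>

lemma hyperfib_0: "hyperfib r 0 = 0"
  by (induction r) auto

lemma hyperfib_1: "hyperfib r (Suc 0) = 1"
  by (induction r) (auto simp: hyperfib_0)

lemma hyperlucas_0: "hyperlucas r 0 = 2"
  by (induction r) auto

lemma hyperfib_Suc_Suc: "hyperfib (Suc r) (Suc n) = hyperfib (Suc r) n + hyperfib r (Suc n)"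
  by simp

lemma hyperlucas_Suc_Suc:
  "hyperlucas (Suc r) (Suc n) = hyperlucas (Suc r) n + hyperlucas r (Suc n)"
  by simp

text \<open>The zero convention for lower index -1 makes Pascal's rule hold at r = 0 too.\<close>

lemma binom_pascal: "binom (Suc a) (int r) = binom a (int r) + binom a (int r - 1)"
  by (cases r) (auto simp: binom_def nat_add_distrib)

lemma binom_self_pred: "binom r (int r - 1) = r"
  by (cases r) (auto simp: binom_def)

text \<open>Shifting the index by one avoids truncated subtraction. \<open>n\<close> stays arbitrary
  because the step uses generation r at the next index.\<close>

lemma hyperlucas_Suc_eq:
  "hyperlucas r (Suc n) =
     hyperfib r n + hyperfib r (Suc (Suc n)) + binom (n + r) (int r - 1)"
proof (induction r arbitrary: n)
  case 0
  show ?case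
    by (induction n rule: fib.induct) (auto simp: binom_def)
next
  case (Suc r)
  note outer_IH = Suc.IH
  show ?case
  proof (induction n)
    case 0
    show ?case
      \<comment> \<open>The extra initial value 2 splits as 1 + 1: one unit is the Fibonacci summand
        at index 1, the other raises the binomial term from r to r + 1.\<close>
      using outer_IH[of 0] binom_self_pred[of r] binom_self_pred[of "Suc r"]
      by (simp add: hyperfib_0 hyperfib_1 hyperlucas_0)
  next
    case (Suc n)
    have "binom (Suc n + Suc r) (int (Suc r) - 1) =
        binom (n + Suc r) (int (Suc r) - 1) + binom (Suc n + r) (int r - 1)"
      using binom_pascal[of "Suc (n + r)" r] by simp
    then show ?case
      using Suc.IH outer_IH[of "Suc n"] hyperlucas_Suc_Suc[of r "Suc n"]
        hyperfib_Suc_Suc[of r n] hyperfib_Suc_Suc[of r "Suc (Suc n)"]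
      by linarith
  qed
qed

theorem theorem3:
  fixes n r :: nat
  assumes "n \<ge> 1"
  shows "hyperlucas r n = hyperfib r (n - 1) + hyperfib r (n + 1) + binom (n + r - 1) (int r - 1)"
  using assms hyperlucas_Suc_eq[of r "n - 1"] by simp

end
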